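(* Let $d\ge1$ be an integer, let $0\le s_j<1$ for $1\le j\le d$, and let $\pi(\beta)=\prod_{j=1}^d2^{s_jd_T(\beta_j)}$, $\beta\in T^d$, be a standard polynomial weight. Let $\mu\ge0$ be a Borel measure on $\overline{T}^d$ with $\mathrm{supp}\,\mu\subset(\partial T)^d$ and finite energy $\mathcal{E}_\pi[\mu]<\infty$. Suppose that: (a) (local charge-energy condition) there is a constant $c_1>0$ such that for every rectangular set $E\subset(\partial T)^d$ $$\mu(E)\ge c_1\sum_{\alpha\in T^d:\ Q_\alpha\subset E}\mu(Q_\alpha)^2\,\pi(\alpha);$$ (b) (maximal function inequality) there is a constant $c_2>0$ such that for every $g\in L^2(\overline{T}^d,d\mu)$ $$\int_{(\partial T)^d}g^2\,d\mu\ge c_2\int_{(\partial T)^d}(\mathcal{M}_\mu g)^2\,d\mu,\qquad (\mathcal{M}_\mu g)(\beta)=\sup_{\alpha\in T^d,\ \alpha\ge\beta}\frac{\int_{Q_\alpha}g\,d\mu}{\mu(Q_\alpha)},\quad \beta\in\overline{T}^d.$$ Then the trace inequality holds: there is a constant $C<\infty$ such that for every $\mu$-measurable $g\ge0$ on $\overline{T}^d$ $$\sum_{\alpha\in T^d}\Big(\int_{\mathcal{S}(\alpha)}g\,d\mu\Big)^2\pi(\alpha)\le C\int_{\overline{T}^d}g^2\,d\mu.$$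
   Context: $T$ denotes the (vertex set of the) rooted infinite binary tree with root $o$, in which every vertex has exactly two children. $\partial T$ is the set of infinite descending paths starting at $o$, and $\overline{T}=T\cup\partial T$. For $\alpha,\beta\in T$ write $\alpha\le\beta$ if $\beta$ lies on the geodesic from $o$ to $\alpha$ (so $o$ is the largest element); for $\omega\in\partial T$, $\omega\le\alpha$ means that $\alpha$ is a vertex on the path $\omega$, or $\alpha=\omega$. For $\alpha,\beta\in\overline{T}$, $\alpha\wedge\beta$ is their least common ancestor (with $\alpha\wedge\alpha=\alpha$), and $d_T(\alpha)$ is the number of vertices $\gamma\in T$ with $\gamma\ge\alpha$ (so $d_T(o)=1$, and $d_T(\omega)=\infty$ for $\omega\in\partial T$). $T^d$, $(\partial T)^d$ and $\overline{T}^d$ are the $d$-fold Cartesian products of $T$, $\partial T$ and $\overline{T}$, with the coordinatewise order. $\overline{T}^d$ carries the topology (and Borel sets) of the metric $\delta(\alpha,\beta)=\sum_{j=1}^d\big(2^{-d_T(\alpha_j\wedge\beta_j)}-\tfrac12(2^{-d_T(\alpha_j)}+2^{-d_T(\beta_j)})\big)$, where $2^{-\infty}=0$. For $\alpha\in T^d$, $\mathcal{S}(\alpha)=\{\beta\in\overline{T}^d:\beta\le\alpha\}$ and $Q_\alpha=\partial\mathcal{S}(\alpha)=\mathcal{S}(\alpha)\cap(\partial T)^d$ (a "dyadic rectangle"). A set $E\subset(\partial T)^d$ is called rectangular if it is a finite union of sets $Q_{\alpha}$, $\alpha\in T^d$. The energy of $\mu$ is $\mathcal{E}_\pi[\mu]=\sum_{\alpha\in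 T^d}\mu(\mathcal{S}(\alpha))^2\pi(\alpha)$. In the definition of $\mathcal{M}_\mu$ the quotient is read as $0$ when $\mu(Q_\alpha)=0$. All functions are real valued. *)

theory Defs
  imports "HOL-Analysis.Analysis" "HOL-Library.Sublist" "HOL-Library.Extended_Nat"
begin

text \<open>A vertex is the list of left/right choices leading to it from the root \<open>[]\<close>; an infinite
  descending path starting at the root is the sequence of its choices, so that its vertices are
  \<open>map \<omega> [0..<n]\<close>.\<close>

datatype tbar = Vertex "bool list" | End "nat \<Rightarrow> bool"

definition tree :: "tbar set" where
  "tree = range Vertex"

definition tree_boundary :: "tbar set" where
  "tree_boundary = range End"

text \<open>In this order the root is the greatest element, so the least common ancestor
  \<open>\<alpha> \<and> \<beta>\<close> is the supremum \<open>sup \<alpha> \<beta>\<close>.\<close>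

instantiation tbar :: order
begin

fun less_eq_tbar :: "tbar \<Rightarrow> tbar \<Rightarrow> bool" where
  "Vertex v \<le> Vertex w \<longleftrightarrow> prefix w v"
| "End \<omega> \<le> Vertex w \<longleftrightarrow> (\<exists>n. w = map \<omega> [0..<n])"
| "End \<omega> \<le> End \<omega>' \<longleftrightarrow> \<omega> = \<omega>'"
| "Vertex v \<le> End \<omega> \<longleftrightarrow> False"

definition less_tbar :: "tbar \<Rightarrow> tbar \<Rightarrow> bool" where
  "\<alpha> < \<beta> \<longleftrightarrow> \<alpha> \<le> \<beta> \<and> \<not> \<beta> \<le> (\<alpha> :: tbar)"

lemma le_refl_tbar: "\<alpha> \<le> (\<alpha> :: tbar)"
  by (cases \<alpha>) auto

lemma prefix_path_iff: "prefix w (map \<omega> [0..<n]) \<longleftrightarrow> length w \<le> n \<and> w = map \<omega> [0..<length w]"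
proof
  assume "prefix w (map \<omega> [0..<n])"
  then have "length w \<le> n" "w = take (length w) (map \<omega> [0..<n])"
    by (auto dest: prefix_length_le) (auto simp: prefix_def)
  then show "length w \<le> n \<and> w = map \<omega> [0..<length w]" by (simp add: take_map)
next
  assume *: "length w \<le> n \<and> w = map \<omega> [0..<length w]"
  then have "w = take (length w) (map \<omega> [0..<n])"
    by (simp add: take_map)
  then show "prefix w (map \<omega> [0..<n])"
    by (metis take_is_prefix)
qed

lemma le_trans_tbar:
  assumes "\<alpha> \<le> \<beta>" "\<beta> \<le> (\<gamma> :: tbar)"
  shows "\<alpha> \<le> \<gamma>"
proof (cases \<alpha>; cases \<beta>; cases \<gamma>)
  fix \<omega> v w
  assume *: "\<alpha> = End \<omega>" "\<beta> = Vertex v" "\<gamma> = Vertex w"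
  with assms obtain n where "prefix w (map \<omega> [0..<n])" by auto
  then have "w = map \<omega> [0..<length w]" by (simp only: prefix_path_iff)
  with * show ?thesis by auto
qed (use assms in auto)

lemma le_antisym_tbar: "\<alpha> \<le> \<beta> \<Longrightarrow> \<beta> \<le> \<alpha> \<Longrightarrow> \<alpha> = (\<beta> :: tbar)"
  by (cases \<alpha>; cases \<beta>) (auto simp: prefix_order.antisym)

instance
proof
  fix \<alpha> \<beta> \<gamma> :: tbar
  show "(\<alpha> < \<beta>) = (\<alpha> \<le> \<beta> \<and> \<not> \<beta> \<le> \<alpha>)" by (rule less_tbar_def)
  show "\<alpha> \<le> \<alpha>" by (rule le_refl_tbar)
  show "\<alpha> \<le> \<beta> \<Longrightarrow> \<beta> \<le> \<gamma> \<Longrightarrow> \<alpha> \<le> \<gamma>" by (rule le_trans_tbar)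
  show "\<alpha> \<le> \<beta> \<Longrightarrow> \<beta> \<le> \<alpha> \<Longrightarrow> \<alpha> = \<beta>" by (rule le_antisym_tbar)
qed

end

lemma above_chain_tbar:
  assumes "\<alpha> \<le> \<beta>" "\<alpha> \<le> (\<gamma> :: tbar)"
  shows "\<beta> \<le> \<gamma> \<or> \<gamma> \<le> \<beta>"
proof (cases \<alpha>; cases \<beta>; cases \<gamma>)
  fix u v w
  assume *: "\<alpha> = Vertex u" "\<beta> = Vertex v" "\<gamma> = Vertex w"
  with assms show ?thesis using prefix_same_cases by auto
next
  fix \<omega> v w
  assume *: "\<alpha> = End \<omega>" "\<beta> = Vertex v" "\<gamma> = Vertex w"
  with assms obtain m n where "v = map \<omega> [0..<m]" "w = map \<omega> [0..<n]" by auto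
  with * show ?thesis by (auto simp: prefix_path_iff nat_le_linear)
qed (use assms in auto)

lemma ex_sup_tbar:
  "\<exists>\<gamma>. (\<alpha> \<le> \<gamma> \<and> \<beta> \<le> \<gamma>) \<and> (\<forall>\<gamma>'. \<alpha> \<le> \<gamma>' \<and> \<beta> \<le> \<gamma>' \<longrightarrow> \<gamma> \<le> (\<gamma>' :: tbar))"
proof (cases "\<alpha> \<le> \<beta> \<or> \<beta> \<le> \<alpha>")
  case True
  then show ?thesis using le_refl_tbar by blast
next
  case False
  define P where "P n \<longleftrightarrow> (\<exists>w. length w = n \<and> \<alpha> \<le> Vertex w \<and> \<beta> \<le> Vertex w)" for n
  have vert: "\<exists>w. \<gamma> = Vertex w" if "\<alpha> \<le> \<gamma>" "\<beta> \<le> \<gamma>" for \<gamma>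
    using that False by (cases \<gamma>; cases \<alpha>; cases \<beta>) auto
  have "P 0" by (cases \<alpha>; cases \<beta>) (auto simp: P_def)
  have "\<exists>b. \<forall>n. P n \<longrightarrow> n \<le> b"
  proof -
    consider v where "\<alpha> = Vertex v" | v where "\<beta> = Vertex v" | \<omega> \<omega>' where "\<alpha> = End \<omega>" "\<beta> = End \<omega>'"
      by (cases \<alpha>; cases \<beta>) auto
    then show ?thesis
    proof cases
      case 1
      then show ?thesis by (intro exI[of _ "length v"]) (auto simp: P_def prefix_length_le)
    next
      case 2
      then show ?thesis by (intro exI[of _ "length v"]) (auto simp: P_def prefix_length_le)
    next
      case 3
      with False obtain k where k: "\<omega> k \<noteq> \<omega>' k" by auto
      have "n \<le> k" if "P n" for n
      proof (rule ccontr)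
        assume "\<not> n \<le> k"
        from that 3 obtain w where "length w = n" "\<exists>m. w = map \<omega> [0..<m]" "\<exists>m. w = map \<omega>' [0..<m]"
          by (auto simp: P_def)
        then obtain m m' where m: "w = map \<omega> [0..<m]" "w = map \<omega>' [0..<m']" by blast
        with arg_cong[OF m(1), of length] arg_cong[OF m(2), of length] \<open>length w = n\<close>
        have "w = map \<omega> [0..<n]" "w = map \<omega>' [0..<n]" by simp_all
        then have "map \<omega> [0..<n] = map \<omega>' [0..<n]" by (rule trans[OF sym])
        then have "map \<omega> [0..<n] ! k = map \<omega>' [0..<n] ! k" by (rule arg_cong)
        with k \<open>\<not> n \<le> k\<close> show False by simp
      qed
      then show ?thesis by blast
    qed
  qed
  then obtain b where b: "\<And>n. P n \<Longrightarrow> n \<le> b" by blast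
  define N where "N = (GREATEST n. P n)"
  have "P N" unfolding N_def using GreatestI_nat[of P 0 b] \<open>P 0\<close> b by blast
  then obtain w where w: "length w = N" "\<alpha> \<le> Vertex w" "\<beta> \<le> Vertex w" by (auto simp: P_def)
  have "Vertex w \<le> \<gamma>" if g: "\<alpha> \<le> \<gamma>" "\<beta> \<le> \<gamma>" for \<gamma>
  proof -
    obtain u where u: "\<gamma> = Vertex u" using vert g by blast
    then have "P (length u)" using g by (auto simp: P_def)
    then have "length u \<le> N" unfolding N_def using Greatest_le_nat[of P _ b] b by blast
    with above_chain_tbar[OF w(2) g(1)] w(1) u show ?thesis
      by (auto simp: prefix_def)
  qed
  with w show ?thesis by blast
qed

instantiation tbar :: semilattice_sup
begin

definition sup_tbar :: "tbar \<Rightarrow> tbar \<Rightarrow> tbar" where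
  "sup \<alpha> \<beta> = (LEAST \<gamma> :: tbar. \<alpha> \<le> \<gamma> \<and> \<beta> \<le> \<gamma>)"

lemma sup_tbar_least:
  "\<alpha> \<le> sup \<alpha> \<beta> \<and> \<beta> \<le> sup \<alpha> \<beta> \<and> (\<forall>\<gamma>. \<alpha> \<le> \<gamma> \<and> \<beta> \<le> \<gamma> \<longrightarrow> sup \<alpha> \<beta> \<le> (\<gamma> :: tbar))"
proof -
  obtain \<gamma> where g: "\<alpha> \<le> \<gamma> \<and> \<beta> \<le> \<gamma>" "\<And>\<gamma>'. \<alpha> \<le> \<gamma>' \<and> \<beta> \<le> \<gamma>' \<Longrightarrow> \<gamma> \<le> \<gamma>'"
    using ex_sup_tbar[of \<alpha> \<beta>] by blast
  have "sup \<alpha> \<beta> = \<gamma>"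
    unfolding sup_tbar_def Least_def using g le_antisym_tbar by (intro the_equality) blast+
  with g show ?thesis by blast
qed

instance
proof
  fix \<alpha> \<beta> \<gamma> :: tbar
  show "\<alpha> \<le> sup \<alpha> \<beta>" "\<beta> \<le> sup \<alpha> \<beta>" using sup_tbar_least by blast+
  show "\<beta> \<le> \<alpha> \<Longrightarrow> \<gamma> \<le> \<alpha> \<Longrightarrow> sup \<beta> \<gamma> \<le> \<alpha>" using sup_tbar_least by blast
qed

end

definition d_T :: "tbar \<Rightarrow> enat" where
  "d_T \<alpha> = (if finite {\<gamma> \<in> tree. \<alpha> \<le> \<gamma>} then enat (card {\<gamma> \<in> tree. \<alpha> \<le> \<gamma>}) else \<infinity>)"

lemma d_T_Vertex [simp]: "d_T (Vertex v) = enat (Suc (length v))"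
proof -
  have "{\<gamma> \<in> tree. Vertex v \<le> \<gamma>} = Vertex ` set (prefixes v)"
    by (auto simp: tree_def)
  moreover have "card (Vertex ` set (prefixes v)) = Suc (length v)"
    by (subst card_image) (auto simp: inj_on_def distinct_card)
  ultimately show ?thesis by (simp add: d_T_def)
qed

lemma d_T_End [simp]: "d_T (End \<omega>) = \<infinity>"
proof -
  have "{\<gamma> \<in> tree. End \<omega> \<le> \<gamma>} = range (\<lambda>n. Vertex (map \<omega> [0..<n]))"
    by (auto simp: tree_def)
  moreover have "inj (\<lambda>n. Vertex (map \<omega> [0..<n]))"
    by (rule inj_on_inverseI[where g = "\<lambda>\<gamma>. case \<gamma> of Vertex w \<Rightarrow> length w"]) simp
  ultimately show ?thesis by (simp add: d_T_def finite_image_iff)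
qed

definition two_pow_minus :: "enat \<Rightarrow> real" where
  "two_pow_minus k = (case k of enat n \<Rightarrow> (1/2) ^ n | \<infinity> \<Rightarrow> 0)"

text \<open>Points of the \<open>d\<close>-fold product of the tree with boundary are functions \<open>'d \<Rightarrow> tbar\<close>; the
  coordinatewise order is the library order on functions.\<close>

definition Td :: "('d \<Rightarrow> tbar) set" where
  "Td = {\<alpha>. \<forall>j. \<alpha> j \<in> tree}"

definition boundary_Td :: "('d \<Rightarrow> tbar) set" where
  "boundary_Td = {\<alpha>. \<forall>j. \<alpha> j \<in> tree_boundary}"

definition delta :: "('d::finite \<Rightarrow> tbar) \<Rightarrow> ('d \<Rightarrow> tbar) \<Rightarrow> real" where
  "delta \<alpha> \<beta> = (\<Sum>j\<in>UNIV. two_pow_minus (d_T (sup (\<alpha> j) (\<beta> j)))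
      - 1/2 * (two_pow_minus (d_T (\<alpha> j)) + two_pow_minus (d_T (\<beta> j))))"

lemma two_pow_minus_simps [simp]:
  "two_pow_minus (enat n) = (1/2) ^ n" "two_pow_minus \<infinity> = 0"
  by (auto simp: two_pow_minus_def)

lemma d_T_antimono:
  assumes "\<alpha> \<le> (\<beta> :: tbar)"
  shows "two_pow_minus (d_T \<alpha>) \<le> two_pow_minus (d_T \<beta>)"
proof (cases \<alpha>; cases \<beta>)
  fix v w
  assume *: "\<alpha> = Vertex v" "\<beta> = Vertex w"
  with assms have "Suc (length w) \<le> Suc (length v)" by (simp add: prefix_length_le)
  then have "(1/2 :: real) ^ Suc (length v) \<le> (1/2) ^ Suc (length w)"
    by (intro power_decreasing) simp_all
  with * show ?thesis by (simp del: power_Suc)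
qed (use assms in auto)

lemma d_T_strict:
  assumes "\<alpha> \<le> (\<beta> :: tbar)" "two_pow_minus (d_T \<alpha>) = two_pow_minus (d_T \<beta>)"
  shows "\<alpha> = \<beta>"
proof (cases \<alpha>; cases \<beta>)
  fix v w
  assume *: "\<alpha> = Vertex v" "\<beta> = Vertex w"
  with assms have "(1/2 :: real) ^ Suc (length v) = (1/2) ^ Suc (length w)"
    by (simp del: power_Suc)
  then have "length v = length w"
    using power_strict_decreasing[of "Suc (length v)" "Suc (length w)" "1/2 :: real"]
      power_strict_decreasing[of "Suc (length w)" "Suc (length v)" "1/2 :: real"]
    by (cases "length v" "length w" rule: linorder_cases) (simp_all del: power_Suc)
  with * assms(1) show ?thesis by (auto simp: prefix_def)
qed (use assms in auto)

interpretation delta: Metric_space UNIV "delta :: ('d::finite \<Rightarrow> tbar) \<Rightarrow> ('d \<Rightarrow> tbar) \<Rightarrow> real"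
proof
  let ?p = "\<lambda>\<alpha>. two_pow_minus (d_T \<alpha>)"
  let ?q = "\<lambda>\<alpha> \<beta>. ?p (sup \<alpha> \<beta>) - 1/2 * (?p \<alpha> + ?p \<beta>)"
  have nonneg: "0 \<le> ?q \<alpha> \<beta>" for \<alpha> \<beta>
    using d_T_antimono[of \<alpha> "sup \<alpha> \<beta>"] d_T_antimono[of \<beta> "sup \<alpha> \<beta>"] by simp
  have zero: "\<alpha> = \<beta>" if "?q \<alpha> \<beta> = 0" for \<alpha> \<beta>
  proof -
    have "?p \<alpha> = ?p (sup \<alpha> \<beta>)" "?p \<beta> = ?p (sup \<alpha> \<beta>)"
      using that d_T_antimono[of \<alpha> "sup \<alpha> \<beta>"] d_T_antimono[of \<beta> "sup \<alpha> \<beta>"] by simp_all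
    then have "\<alpha> = sup \<alpha> \<beta>" "\<beta> = sup \<alpha> \<beta>"
      by - (erule d_T_strict[OF sup_ge1], erule d_T_strict[OF sup_ge2])
    then show ?thesis by (rule trans[OF _ sym])
  qed
  have tri: "?q \<alpha> \<gamma> \<le> ?q \<alpha> \<beta> + ?q \<beta> \<gamma>" for \<alpha> \<beta> \<gamma>
  proof -
    have *: "?p \<beta> \<le> ?p (sup \<alpha> \<beta>)" "?p \<beta> \<le> ?p (sup \<beta> \<gamma>)" by (auto intro!: d_T_antimono)
    have "sup \<alpha> \<beta> \<le> sup \<beta> \<gamma> \<or> sup \<beta> \<gamma> \<le> sup \<alpha> \<beta>"
      by (rule above_chain_tbar[of \<beta>]) auto
    then have "sup \<alpha> \<gamma> \<le> sup \<beta> \<gamma> \<or> sup \<alpha> \<gamma> \<le> sup \<alpha> \<beta>"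
      by (meson le_supI order_trans sup_ge1 sup_ge2)
    then have "?p (sup \<alpha> \<gamma>) \<le> ?p (sup \<beta> \<gamma>) \<or> ?p (sup \<alpha> \<gamma>) \<le> ?p (sup \<alpha> \<beta>)"
      using d_T_antimono by blast
    with * show ?thesis by (auto simp: field_simps)
  qed
  fix \<alpha> \<beta> \<gamma> :: "'d \<Rightarrow> tbar"
  show "0 \<le> delta \<alpha> \<beta>" unfolding delta_def by (intro sum_nonneg nonneg)
  show "delta \<alpha> \<beta> = delta \<beta> \<alpha>" unfolding delta_def by (simp add: sup_commute add.commute)
  show "(delta \<alpha> \<beta> = 0) = (\<alpha> = \<beta>)"
  proof
    assume "delta \<alpha> \<beta> = 0"
    then have "\<forall>j\<in>UNIV. ?q (\<alpha> j) (\<beta> j) = 0"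
      unfolding delta_def using nonneg by (subst (asm) sum_nonneg_eq_0_iff) auto
    then show "\<alpha> = \<beta>" using zero by (intro ext) blast
  qed (simp add: delta_def)
  show "delta \<alpha> \<gamma> \<le> delta \<alpha> \<beta> + delta \<beta> \<gamma>"
    unfolding delta_def sum.distrib[symmetric] by (intro sum_mono tri)
qed

definition borel_Td :: "('d::finite \<Rightarrow> tbar) measure" where
  "borel_Td = sigma UNIV {U. openin delta.mtopology U}"

definition supp :: "('d::finite \<Rightarrow> tbar) measure \<Rightarrow> ('d \<Rightarrow> tbar) set" where
  "supp \<mu> = {x. \<forall>U. openin delta.mtopology U \<and> x \<in> U \<longrightarrow> emeasure \<mu> U > 0}"

definition succ_set :: "('d \<Rightarrow> tbar) \<Rightarrow> ('d \<Rightarrow> tbar) set" where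
  "succ_set \<alpha> = {\<beta>. \<beta> \<le> \<alpha>}"

definition Q :: "('d \<Rightarrow> tbar) \<Rightarrow> ('d \<Rightarrow> tbar) set" where
  "Q \<alpha> = succ_set \<alpha> \<inter> boundary_Td"

definition rectangular :: "('d \<Rightarrow> tbar) set \<Rightarrow> bool" where
  "rectangular E \<longleftrightarrow> (\<exists>A. finite A \<and> A \<subseteq> Td \<and> E = (\<Union>\<alpha>\<in>A. Q \<alpha>))"

text \<open>Only used for \<open>\<beta> \<in> Td\<close>, where \<open>d_T\<close> is finite.\<close>

definition poly_weight :: "('d::finite \<Rightarrow> real) \<Rightarrow> ('d \<Rightarrow> tbar) \<Rightarrow> real" where
  "poly_weight s \<beta> = (\<Prod>j\<in>UNIV. 2 powr (s j * real (the_enat (d_T (\<beta> j)))))"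

definition energy :: "(('d::finite \<Rightarrow> tbar) \<Rightarrow> real) \<Rightarrow> ('d \<Rightarrow> tbar) measure \<Rightarrow> ennreal" where
  "energy \<pi> \<mu> = (\<Sum>\<^sub>\<infinity>\<alpha>\<in>Td. (emeasure \<mu> (succ_set \<alpha>))\<^sup>2 * ennreal (\<pi> \<alpha>))"

text \<open>The supremum may be infinite, hence extended real values. The quotient is a real one, so it
  is \<open>0\<close> when \<open>\<mu> (Q \<alpha>) = 0\<close>.\<close>

definition max_fun ::
    "('d::finite \<Rightarrow> tbar) measure \<Rightarrow> (('d \<Rightarrow> tbar) \<Rightarrow> real) \<Rightarrow> ('d \<Rightarrow> tbar) \<Rightarrow> ereal" where
  "max_fun \<mu> g \<beta> = (SUP \<alpha>\<in>{\<alpha> \<in> Td. \<beta> \<le> \<alpha>}. ereal ((LINT x:Q \<alpha>|\<mu>. g x) / measure \<mu> (Q \<alpha>)))"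

text \<open>Borel representatives of the elements of \<open>L\<^sup>2(\<mu>)\<close>.\<close>

definition L2 :: "('d::finite \<Rightarrow> tbar) measure \<Rightarrow> (('d \<Rightarrow> tbar) \<Rightarrow> real) set" where
  "L2 \<mu> = {g \<in> borel_measurable \<mu>. integrable \<mu> (\<lambda>x. (g x)\<^sup>2)}"

end

theory Submission
  imports Defs
begin

text \<open>
  Finite energy makes \<open>\<mu>\<close> a finite measure, and since the space is separable, \<open>\<mu>\<close> is concentrated on
  \<open>(\<partial>T)\<^sup>d\<close>. With the averages \<open>A\<^sub>\<alpha> = \<integral>\<^bsub>Q\<^sub>\<alpha>\<^esub> g d\<mu> / \<mu>(Q\<^sub>\<alpha>)\<close> the left-hand side of the trace inequality is
  \<open>\<Sum> A\<^sub>\<alpha>\<^sup>2 \<mu>(Q\<^sub>\<alpha>)\<^sup>2 \<pi>(\<alpha>)\<close>. The charge-energy condition, applied to finite unions of the \<open>Q\<^sub>\<alpha>\<close> lying over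
  a level set \<open>{A\<^sub>\<alpha>\<^sup>2 > t}\<close>, bounds each layer of this sum by \<open>\<mu>{(\<M>\<^sub>\<mu> g)\<^sup>2 > t} / c1\<close>; adding up
  the layers gives \<open>\<integral> (\<M>\<^sub>\<mu> g)\<^sup>2 d\<mu> / c1\<close>, to which the maximal inequality applies. So \<open>C = 1 / (c1 c2)\<close>.
\<close>

section \<open>The metric on the product tree: open successor sets and dense vertices\<close>

text \<open>A strict ancestor of a vertex has smaller depth by at least one, so 2 to the minus depth
  at least doubles. This gap makes successor sets open.\<close>

lemma two_pow_minus_Vertex_less:
  assumes "Vertex v < \<gamma>"
  shows "2 * two_pow_minus (d_T (Vertex v)) \<le> two_pow_minus (d_T \<gamma>)"
proof (cases \<gamma>)
  case (Vertex w)
  with assms have "strict_prefix w v"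
    by (auto simp: less_tbar_def strict_prefix_def)
  then have "Suc (length w) \<le> length v"
    by (metis Suc_leI prefix_length_less)
  then have "(1/2 :: real) ^ length v \<le> (1/2) ^ Suc (length w)"
    by (intro power_decreasing) simp_all
  with Vertex show ?thesis by simp
qed (use assms in \<open>auto simp: less_tbar_def\<close>)

lemma delta_coordinate_nonneg:
  "0 \<le> two_pow_minus (d_T (sup a b)) - 1/2 * (two_pow_minus (d_T a) + two_pow_minus (d_T b))"
  using d_T_antimono[of a "sup a b"] d_T_antimono[of b "sup a b"] by simp

lemma delta_coordinate_le:
  "two_pow_minus (d_T (sup (\<alpha> j) (\<beta> j)))
     - 1/2 * (two_pow_minus (d_T (\<alpha> j)) + two_pow_minus (d_T (\<beta> j))) \<le> delta \<alpha> \<beta>"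
  unfolding delta_def
  by (rule member_le_sum[of j UNIV
        "\<lambda>j. two_pow_minus (d_T (sup (\<alpha> j) (\<beta> j)))
           - 1/2 * (two_pow_minus (d_T (\<alpha> j)) + two_pow_minus (d_T (\<beta> j)))"])
    (use delta_coordinate_nonneg in auto)

text \<open>The ancestors of \<open>a\<close> form a chain, so \<open>sup a b\<close> is comparable
  with \<open>Vertex v\<close>; as \<open>b\<close> is not below \<open>Vertex v\<close>, it lies
  strictly above. With p and s the weights of \<open>Vertex v\<close> and \<open>sup a b\<close>,
  the contribution is at least s - (p + s)/2, and s \<ge> 2p turns this into p/2.\<close>

lemma delta_coordinate_outside:
  assumes "a \<le> Vertex v" "\<not> b \<le> Vertex v"
  shows "two_pow_minus (d_T (Vertex v)) / 2
    \<le> two_pow_minus (d_T (sup a b)) - 1/2 * (two_pow_minus (d_T a) + two_pow_minus (d_T b))"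
proof -
  have "\<not> sup a b \<le> Vertex v"
    using assms(2) by simp
  moreover have "sup a b \<le> Vertex v \<or> Vertex v \<le> sup a b"
    using assms(1) by (intro above_chain_tbar[of a]) auto
  ultimately have "Vertex v < sup a b"
    by (auto simp: less_le_not_le)
  have arith: "p / 2 \<le> s - 1/2 * (x + y)" if "2 * p \<le> s" "x \<le> p" "y \<le> s" for p s x y :: real
    using that by (simp add: field_simps)
  show ?thesis
    using \<open>Vertex v < sup a b\<close> assms(1)
    by (intro arith two_pow_minus_Vertex_less d_T_antimono) auto
qed

lemma Td_conv_range: "Td = range (\<lambda>v j. Vertex (v j))"
proof -
  have "\<alpha> \<in> range (\<lambda>v j. Vertex (v j))" if "\<alpha> \<in> Td" for \<alpha> :: "'a \<Rightarrow> tbar"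
  proof -
    from that have "\<forall>j. \<exists>v. \<alpha> j = Vertex v" by (auto simp: Td_def tree_def)
    then obtain v where "\<forall>j. \<alpha> j = Vertex (v j)" by metis
    then have "\<alpha> = (\<lambda>j. Vertex (v j))" by auto
    then show ?thesis by blast
  qed
  then show ?thesis by (auto simp: Td_def tree_def)
qed

lemma countable_Td: "countable (Td :: ('d::finite \<Rightarrow> tbar) set)"
  unfolding Td_conv_range by (intro countable_image) simp

lemma openin_succ_set:
  fixes \<alpha> :: "'d::finite \<Rightarrow> tbar"
  assumes "\<alpha> \<in> Td"
  shows "openin delta.mtopology (succ_set \<alpha>)"
  unfolding delta.openin_mtopology
proof (intro conjI allI impI)
  fix \<beta> assume \<beta>: "\<beta> \<in> succ_set \<alpha>"
  obtain v where v: "\<alpha> = (\<lambda>j. Vertex (v j))"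
    using assms by (auto simp: Td_conv_range)
  \<comment> \<open>A point outside \<open>succ_set \<alpha>\<close> fails in some coordinate j,
    where it is at distance at least half the weight of \<open>\<alpha> j\<close>. Finitely many
    coordinates give a positive minimum.\<close>
  define r where "r = Min ((\<lambda>j. two_pow_minus (d_T (\<alpha> j)) / 2) ` UNIV)"
  have r0: "r > 0" unfolding r_def by (subst Min_gr_iff) (auto simp: v)
  have r_le: "r \<le> two_pow_minus (d_T (\<alpha> j)) / 2" for j
    unfolding r_def by (intro Min_le) auto
  have "\<gamma> \<in> succ_set \<alpha>" if "delta \<beta> \<gamma> < r" for \<gamma>
  proof (rule ccontr)
    assume "\<gamma> \<notin> succ_set \<alpha>"
    then obtain j where j: "\<not> \<gamma> j \<le> \<alpha> j"
      by (auto simp: succ_set_def le_fun_def)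
    from \<beta> have "\<beta> j \<le> \<alpha> j" by (auto simp: succ_set_def le_fun_def)
    with j have "two_pow_minus (d_T (\<alpha> j)) / 2 \<le> delta \<beta> \<gamma>"
      using delta_coordinate_outside[of "\<beta> j" "v j" "\<gamma> j"] delta_coordinate_le[of \<beta> j \<gamma>]
      unfolding v by (meson order_trans)
    with r_le[of j] that show False by simp
  qed
  with r0 show "\<exists>r>0. delta.mball \<beta> r \<subseteq> succ_set \<alpha>"
    by (intro exI[of _ r]) auto
qed auto

lemma Td_dense:
  fixes x :: "'d::finite \<Rightarrow> tbar"
  assumes "0 < e"
  shows "\<exists>\<alpha>\<in>Td. delta x \<alpha> < e"
proof -
  have "(\<lambda>n. real CARD('d) * (1/2) ^ n) \<longlonglongrightarrow> real CARD('d) * 0"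
    by (intro tendsto_intros LIMSEQ_power_zero) simp
  then have "eventually (\<lambda>n. real CARD('d) * (1/2) ^ n < e) sequentially"
    using assms by (intro order_tendstoD(2)) auto
  then obtain n where n: "real CARD('d) * (1/2) ^ n < e"
    by (auto simp: eventually_sequentially)
  \<comment> \<open>Each end is cut off at depth n and vertices are kept. A kept coordinate
    contributes 0 to the distance, a cut one 2^-(n+2).\<close>
  define \<alpha> where
    "\<alpha> j = (case x j of Vertex v \<Rightarrow> Vertex v | End \<omega> \<Rightarrow> Vertex (map \<omega> [0..<n]))" for j
  have "\<alpha> \<in> Td"
    by (auto simp: Td_def tree_def \<alpha>_def split: tbar.splits)
  moreover have "two_pow_minus (d_T (sup (x j) (\<alpha> j)))
      - 1/2 * (two_pow_minus (d_T (x j)) + two_pow_minus (d_T (\<alpha> j))) \<le> (1/2) ^ n" for j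
  proof -
    have "x j \<le> \<alpha> j" by (cases "x j") (auto simp: \<alpha>_def)
    then have "sup (x j) (\<alpha> j) = \<alpha> j" by (rule sup_absorb2)
    then show ?thesis by (cases "x j") (auto simp: \<alpha>_def)
  qed
  then have "delta x \<alpha> \<le> (\<Sum>j\<in>(UNIV :: 'd set). (1/2) ^ n)"
    unfolding delta_def by (intro sum_mono)
  ultimately show ?thesis using n by (intro bexI[of _ \<alpha>]) auto
qed

section \<open>Borel sets\<close>

lemma space_borel_Td [simp]: "space borel_Td = UNIV"
  by (simp add: borel_Td_def)

lemma openin_sets_borel_Td: "openin delta.mtopology U \<Longrightarrow> U \<in> sets borel_Td"
  by (simp add: borel_Td_def)

text \<open>An end has an ancestor at every depth, a vertex none below its own. Putting the root in
  the other coordinates constrains coordinate j alone. In this form the boundary is visibly Borel,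
  since the successor sets are open.\<close>

lemma boundary_Td_conv_succ_set:
  "boundary_Td = (\<Inter>j. \<Inter>n. \<Union>v\<in>{v. length v = n}. succ_set ((\<lambda>_. Vertex [])(j := Vertex v)))"
proof -
  have root: "a \<le> Vertex []" for a
    by (cases a) auto
  have "(\<exists>v. length v = n \<and> \<beta> \<in> succ_set ((\<lambda>_. Vertex [])(j := Vertex v)))
      \<longleftrightarrow> (\<exists>v. length v = n \<and> \<beta> j \<le> Vertex v)" for \<beta> :: "'a \<Rightarrow> tbar" and j n
    using root by (auto simp: succ_set_def le_fun_def)
  moreover have "(\<forall>n. \<exists>v. length v = n \<and> a \<le> Vertex v) \<longleftrightarrow> a \<in> tree_boundary" for a
  proof (cases a)
    case (Vertex w)
    then have "\<not> (\<exists>v. length v = Suc (length w) \<and> a \<le> Vertex v)"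
      by (auto dest: prefix_length_le)
    with Vertex show ?thesis by (auto simp: tree_boundary_def)
  next
    case (End \<omega>)
    then have "length (map \<omega> [0..<n]) = n \<and> a \<le> Vertex (map \<omega> [0..<n])" for n
      by auto
    with End show ?thesis unfolding tree_boundary_def by blast
  qed
  ultimately show ?thesis
    by (simp add: set_eq_iff boundary_Td_def)
qed

lemma succ_set_measurable: "\<alpha> \<in> Td \<Longrightarrow> succ_set \<alpha> \<in> sets borel_Td"
  by (intro openin_sets_borel_Td openin_succ_set)

lemma boundary_Td_measurable: "(boundary_Td :: ('d::finite \<Rightarrow> tbar) set) \<in> sets borel_Td"
  unfolding boundary_Td_conv_succ_set
  by (intro sets.countable_INT'' sets.countable_UN'' countableI_type succ_set_measurable)
    (use sets.top[of borel_Td] in \<open>auto simp: Td_def tree_def\<close>)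

lemma Q_measurable: "\<alpha> \<in> Td \<Longrightarrow> Q \<alpha> \<in> sets borel_Td"
  unfolding Q_def by (intro sets.Int succ_set_measurable boundary_Td_measurable)

section \<open>Concentration on the boundary and finiteness of the measure\<close>

text \<open>By separability, the complement of the support is covered by countably many null balls
  with vertices as centres and radii 1/(n+1).\<close>

lemma AE_in_supp:
  fixes \<mu> :: "('d::finite \<Rightarrow> tbar) measure"
  assumes borel: "sets \<mu> = sets borel_Td"
  shows "AE x in \<mu>. x \<in> supp \<mu>"
proof -
  define B where "B = (\<lambda>(\<alpha>, n). delta.mball \<alpha> (1 / Suc n)) ` (Td \<times> (UNIV :: nat set))
    \<inter> {U. emeasure \<mu> U = 0}"
  have "countable B"
    unfolding B_def by (intro countable_Int1 countable_image countable_SIGMA countable_Td) auto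
  have "U \<in> null_sets \<mu>" if "U \<in> B" for U
    using that borel by (auto simp: B_def null_sets_def intro!: openin_sets_borel_Td)
  then have "(\<Union>U\<in>B. U) \<in> null_sets \<mu>"
    using \<open>countable B\<close> by (intro null_sets_UN') auto
  moreover have "x \<in> \<Union> B" if "x \<notin> supp \<mu>" for x
  proof -
    from that obtain U where U: "openin delta.mtopology U" "x \<in> U" "emeasure \<mu> U = 0"
      by (auto simp: supp_def)
    then obtain r where r: "r > 0" "delta.mball x r \<subseteq> U"
      by (auto simp: delta.openin_mtopology)
    \<comment> \<open>Half of r suffices: a ball of radius 1/(n+1) that contains x lies within
      distance 2/(n+1) < r of x, hence inside the null set U.\<close>
    then obtain n where n: "1 / Suc n < r / 2"
      using nat_approx_posE[of "r / 2"] by auto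
    obtain \<alpha> where \<alpha>: "\<alpha> \<in> Td" "delta x \<alpha> < 1 / Suc n"
      using Td_dense[of "1 / Suc n" x] by auto
    have "y \<in> U" if "delta \<alpha> y < 1 / Suc n" for y
      using delta.triangle[of x \<alpha> y] \<alpha> n that r(2) by auto
    then have "delta.mball \<alpha> (1 / Suc n) \<subseteq> U" by auto
    then have "emeasure \<mu> (delta.mball \<alpha> (1 / Suc n)) \<le> emeasure \<mu> U"
      using U borel by (intro emeasure_mono openin_sets_borel_Td) (auto simp: openin_sets_borel_Td)
    with U(3) have "delta.mball \<alpha> (1 / Suc n) \<in> B"
      using \<alpha> by (force simp: B_def)
    moreover have "x \<in> delta.mball \<alpha> (1 / Suc n)"
      using \<alpha> by (simp add: delta.commute)
    ultimately show ?thesis by blast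
  qed
  ultimately show ?thesis
    by (intro AE_I'[of "\<Union>U\<in>B. U"]) auto
qed

lemma member_le_infsum_ennreal:
  fixes f :: "'a \<Rightarrow> ennreal"
  assumes "finite F" "F \<subseteq> A"
  shows "sum f F \<le> infsum f A"
proof -
  have "infsum f F \<le> infsum f A"
    using assms(2) by (intro infsum_mono_neutral nonneg_summable_on_complete) auto
  with assms(1) show ?thesis by simp
qed

text \<open>The root term of the energy alone is the square of the total mass times the positive
  weight of the root.\<close>

lemma finite_measure_if_energy_finite:
  fixes \<mu> :: "('d::finite \<Rightarrow> tbar) measure"
  assumes borel: "sets \<mu> = sets borel_Td"
    and pos: "\<And>\<beta>. \<beta> \<in> Td \<Longrightarrow> 0 < \<pi> \<beta>"
    and energy: "energy \<pi> \<mu> < \<infinity>"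
  shows "finite_measure \<mu>"
proof
  let ?o = "(\<lambda>_. Vertex []) :: 'd \<Rightarrow> tbar"
  have o: "?o \<in> Td" by (auto simp: Td_def tree_def)
  have "a \<le> Vertex []" for a
    by (cases a) auto
  then have "succ_set ?o = space \<mu>"
    using sets_eq_imp_space_eq[OF borel] by (auto simp: succ_set_def le_fun_def)
  moreover have "(emeasure \<mu> (succ_set ?o))\<^sup>2 * ennreal (\<pi> ?o) \<le> energy \<pi> \<mu>"
    using member_le_infsum_ennreal[of "{?o}" Td
        "\<lambda>\<alpha>. (emeasure \<mu> (succ_set \<alpha>))\<^sup>2 * ennreal (\<pi> \<alpha>)"] o by (simp add: energy_def)
  ultimately have "(emeasure \<mu> (space \<mu>))\<^sup>2 * ennreal (\<pi> ?o) < \<infinity>"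
    using energy by (metis order_le_less_trans)
  with pos[OF o] show "emeasure \<mu> (space \<mu>) \<noteq> \<infinity>"
    by (auto simp: ennreal_top_mult)
qed

section \<open>Carleson embedding over a finite family\<close>

text \<open>Induction on \<open>F\<close> peels off the horizontal layer at height \<open>Min (A ` F)\<close>, so the layer-cake
  formula is not needed.\<close>

lemma carleson_embedding:
  fixes A a :: "'i \<Rightarrow> ennreal"
  assumes "finite F"
    and "\<And>\<alpha>. \<alpha> \<in> F \<Longrightarrow> R \<alpha> \<in> sets M"
    and "\<And>G. G \<subseteq> F \<Longrightarrow> c * sum a G \<le> emeasure M (\<Union>\<alpha>\<in>G. R \<alpha>)"
    and "h \<in> borel_measurable M"
    and "\<And>\<alpha>. \<alpha> \<in> F \<Longrightarrow> A \<alpha> < \<infinity>"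
    and "\<And>\<alpha> x. \<alpha> \<in> F \<Longrightarrow> x \<in> R \<alpha> \<Longrightarrow> A \<alpha> \<le> h x"
  shows "c * (\<Sum>\<alpha>\<in>F. A \<alpha> * a \<alpha>) \<le> (\<integral>\<^sup>+x. h x \<partial>M)"
  using assms
proof (induction F arbitrary: A h rule: finite_psubset_induct)
  case (psubset F)
  show ?case
  proof (cases "F = {}")
    case False
    define m where "m = Min (A ` F)"
    have "m \<in> A ` F" unfolding m_def using psubset.hyps False by (intro Min_in) auto
    then obtain \<alpha>\<^sub>0 where \<alpha>\<^sub>0: "\<alpha>\<^sub>0 \<in> F" "A \<alpha>\<^sub>0 = m" by auto
    have m_le: "m \<le> A \<alpha>" if "\<alpha> \<in> F" for \<alpha>
      unfolding m_def using psubset.hyps that by (intro Min_le) auto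
    let ?U = "\<Union>\<alpha>\<in>F. R \<alpha>"
    have U: "?U \<in> sets M"
      using psubset.hyps psubset.prems(1) by (intro sets.finite_UN) auto
    note h = psubset.prems(3)
    have "c * (\<Sum>\<alpha>\<in>F - {\<alpha>\<^sub>0}. (A \<alpha> - m) * a \<alpha>) \<le> (\<integral>\<^sup>+x. h x - m \<partial>M)"
    proof (rule psubset.IH)
      show "F - {\<alpha>\<^sub>0} \<subset> F" using \<alpha>\<^sub>0 by auto
      show "A \<alpha> - m \<le> h x - m" if "\<alpha> \<in> F - {\<alpha>\<^sub>0}" "x \<in> R \<alpha>" for \<alpha> x
        using psubset.prems(5) that by (intro ennreal_minus_mono) auto
      show "c * sum a G \<le> emeasure M (\<Union>\<alpha>\<in>G. R \<alpha>)" if "G \<subseteq> F - {\<alpha>\<^sub>0}" for G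
        using psubset.prems(2) that by blast
      show "A \<alpha> - m < \<infinity>" if "\<alpha> \<in> F - {\<alpha>\<^sub>0}" for \<alpha>
        using psubset.prems(4)[of \<alpha>] that by (auto intro: order_le_less_trans[OF diff_le_self_ennreal])
    qed (use psubset.prems(1) h in auto)
    \<comment> \<open>The bottom layer has constant height m, so the packing hypothesis for all of F
      bounds it.\<close>
    moreover have "c * (\<Sum>\<alpha>\<in>F. m * a \<alpha>) \<le> m * emeasure M ?U"
    proof -
      have "c * (\<Sum>\<alpha>\<in>F. m * a \<alpha>) = m * (c * sum a F)"
        by (simp add: sum_distrib_left mult_ac)
      also have "\<dots> \<le> m * emeasure M ?U"
        by (intro mult_left_mono psubset.prems(2)) auto
      finally show ?thesis .
    qed
    moreover have "(\<Sum>\<alpha>\<in>F. A \<alpha> * a \<alpha>)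
      = (\<Sum>\<alpha>\<in>F. m * a \<alpha>) + (\<Sum>\<alpha>\<in>F - {\<alpha>\<^sub>0}. (A \<alpha> - m) * a \<alpha>)"
    proof -
      have "(\<Sum>\<alpha>\<in>F. A \<alpha> * a \<alpha>) = (\<Sum>\<alpha>\<in>F. m * a \<alpha> + (A \<alpha> - m) * a \<alpha>)"
        by (intro sum.cong refl)
          (metis distrib_right add.commute diff_add_cancel_ennreal m_le)
      also have "(\<Sum>\<alpha>\<in>F. m * a \<alpha> + (A \<alpha> - m) * a \<alpha>)
        = (\<Sum>\<alpha>\<in>F. m * a \<alpha>) + (\<Sum>\<alpha>\<in>F. (A \<alpha> - m) * a \<alpha>)"
        by (rule sum.distrib)
      \<comment> \<open>The term at the minimum vanishes because m is finite; in
        \<open>ennreal\<close>, \<infinity> - \<infinity> is \<infinity>.\<close>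
      also have "(\<Sum>\<alpha>\<in>F. (A \<alpha> - m) * a \<alpha>) = (\<Sum>\<alpha>\<in>F - {\<alpha>\<^sub>0}. (A \<alpha> - m) * a \<alpha>)"
        using psubset.hyps psubset.prems(4) \<alpha>\<^sub>0
        by (intro sum.mono_neutral_right) (auto simp: less_top)
      finally show ?thesis .
    qed
    ultimately have "c * (\<Sum>\<alpha>\<in>F. A \<alpha> * a \<alpha>) \<le> m * emeasure M ?U + (\<integral>\<^sup>+x. h x - m \<partial>M)"
      by (simp add: distrib_left add_mono)
    also have "\<dots> = (\<integral>\<^sup>+x. m * indicator ?U x + (h x - m) \<partial>M)"
      using U h by (subst nn_integral_add) (auto simp: nn_integral_cmult_indicator)
    \<comment> \<open>On the union h is at least m, so the two layers add up to h exactly; off it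
      only h - m \<le> h is left.\<close>
    also have "\<dots> \<le> (\<integral>\<^sup>+x. h x \<partial>M)"
    proof (intro nn_integral_mono)
      fix x
      show "m * indicator ?U x + (h x - m) \<le> h x"
      proof (cases "x \<in> ?U")
        case True
        then obtain \<alpha> where "\<alpha> \<in> F" "x \<in> R \<alpha>" by auto
        then have "m \<le> h x" using psubset.prems(5) m_le order_trans by blast
        then have "m + (h x - m) = h x" by (metis add.commute diff_add_cancel_ennreal)
        moreover have "m * indicator ?U x = m" using True by simp
        ultimately show ?thesis by (simp only: order_refl)
      next
        case False
        then show ?thesis by (simp add: diff_le_self_ennreal)
      qed
    qed
    finally show ?thesis .
  qed simp
qed

section \<open>From the maximal function to the trace inequality\<close>

text \<open>The average is one of the competitors in the supremum; since it is nonnegative, squaring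
  preserves the inequality.\<close>

lemma max_fun_square_ge:
  assumes "\<alpha> \<in> Td" "\<beta> \<le> \<alpha>" "\<And>x. 0 \<le> g x"
  shows "ennreal (((LINT x:Q \<alpha>|\<mu>. g x) / measure \<mu> (Q \<alpha>))\<^sup>2) \<le> e2ennreal ((max_fun \<mu> g \<beta>)\<^sup>2)"
proof -
  let ?A = "(LINT x:Q \<alpha>|\<mu>. g x) / measure \<mu> (Q \<alpha>)"
  have A0: "0 \<le> ?A"
    using assms(3) by (intro divide_nonneg_nonneg)
      (auto simp: set_lebesgue_integral_def intro!: integral_nonneg_AE)
  have "ereal ?A \<le> max_fun \<mu> g \<beta>"
    unfolding max_fun_def using assms(1,2) by (intro SUP_upper) auto
  with A0 have "ereal ?A * ereal ?A \<le> max_fun \<mu> g \<beta> * max_fun \<mu> g \<beta>"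
    by (intro ereal_mult_mono') auto
  then have "ereal (?A\<^sup>2) \<le> (max_fun \<mu> g \<beta>)\<^sup>2"
    by (simp add: power2_eq_square)
  then show ?thesis
    using e2ennreal_mono by fastforce
qed

text \<open>\<open>carleson_embedding\<close> is applied with squared averages as heights and
  \<open>(emeasure \<mu> (Q \<alpha>))\<^sup>2 * ennreal (\<pi> \<alpha>)\<close> as masses. The
  charge-energy condition is exactly its packing hypothesis.\<close>

lemma trace_inequality_L2:
  fixes \<mu> :: "('d::finite \<Rightarrow> tbar) measure"
  assumes borel: "sets \<mu> = sets borel_Td"
    and fin: "finite_measure \<mu>"
    and boundary: "AE x in \<mu>. x \<in> boundary_Td"
    and charge_energy: "\<And>E. rectangular E \<Longrightarrow>
      ennreal c1 * (\<Sum>\<^sub>\<infinity>\<alpha>\<in>{\<alpha> \<in> Td. Q \<alpha> \<subseteq> E}. (emeasure \<mu> (Q \<alpha>))\<^sup>2 * ennreal (\<pi> \<alpha>))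
        \<le> emeasure \<mu> E"
    and g: "g \<in> L2 \<mu>" and nonneg: "\<And>x. 0 \<le> g x"
    and F: "finite F" "F \<subseteq> Td"
  shows "ennreal c1 * (\<Sum>\<alpha>\<in>F. (\<integral>\<^sup>+\<beta>\<in>succ_set \<alpha>. ennreal (g \<beta>) \<partial>\<mu>)\<^sup>2 * ennreal (\<pi> \<alpha>))
    \<le> (\<integral>\<^sup>+\<beta>\<in>boundary_Td. e2ennreal ((max_fun \<mu> g \<beta>)\<^sup>2) \<partial>\<mu>)"
proof -
  interpret finite_measure \<mu> by fact
  define A where "A \<alpha> = (LINT x:Q \<alpha>|\<mu>. g x) / measure \<mu> (Q \<alpha>)" for \<alpha>
  have Q: "Q \<alpha> \<in> sets \<mu>" if "\<alpha> \<in> Td" for \<alpha>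
    using Q_measurable[OF that] borel by simp
  have [measurable]: "g \<in> borel_measurable \<mu>" and g2: "integrable \<mu> (\<lambda>x. (g x)\<^sup>2)"
    using g by (auto simp: L2_def)
  have int: "integrable \<mu> g"
    using g2 by (rule square_integrable_imp_integrable[rotated]) simp
  have avg: "(\<integral>\<^sup>+\<beta>\<in>succ_set \<alpha>. ennreal (g \<beta>) \<partial>\<mu>)\<^sup>2 * ennreal (\<pi> \<alpha>)
      = ennreal ((A \<alpha>)\<^sup>2) * ((emeasure \<mu> (Q \<alpha>))\<^sup>2 * ennreal (\<pi> \<alpha>))" if "\<alpha> \<in> Td" for \<alpha>
  proof -
    have "(\<integral>\<^sup>+\<beta>\<in>succ_set \<alpha>. ennreal (g \<beta>) \<partial>\<mu>) = (\<integral>\<^sup>+\<beta>. ennreal (indicator (Q \<alpha>) \<beta> * g \<beta>) \<partial>\<mu>)"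
      using boundary by (intro nn_integral_cong_AE) (auto simp: Q_def indicator_def)
    also have "\<dots> = ennreal (LINT x:Q \<alpha>|\<mu>. g x)"
      unfolding set_lebesgue_integral_def real_scaleR_def
      using nonneg Q[OF that] int
      by (intro nn_integral_eq_integral integrable_mult_indicator[of _ \<mu> g, simplified]) auto
    also have "\<dots> = ennreal (A \<alpha>) * emeasure \<mu> (Q \<alpha>)"
    \<comment> \<open>On a null rectangle division by zero makes \<open>A \<alpha>\<close> zero, but
      the integral over it vanishes too, so the identity persists.\<close>
    proof (cases "measure \<mu> (Q \<alpha>) = 0")
      case True
      then have "AE x in \<mu>. x \<notin> Q \<alpha>"
        using Q[OF that] by (intro AE_not_in) (simp add: null_sets_def emeasure_eq_measure)
      then have "AE x in \<mu>. indicat_real (Q \<alpha>) x *\<^sub>R g x = 0"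
        by eventually_elim auto
      then have "(LINT x:Q \<alpha>|\<mu>. g x) = 0"
        unfolding set_lebesgue_integral_def by (intro integral_eq_zero_AE)
      with True show ?thesis by (simp add: emeasure_eq_measure)
    next
      case False
      then show ?thesis
        by (simp add: A_def emeasure_eq_measure ennreal_mult''[symmetric])
    qed
    finally have "(\<integral>\<^sup>+\<beta>\<in>succ_set \<alpha>. ennreal (g \<beta>) \<partial>\<mu>) = ennreal (A \<alpha>) * emeasure \<mu> (Q \<alpha>)" .
    moreover have "0 \<le> A \<alpha>"
      unfolding A_def set_lebesgue_integral_def using nonneg
      by (intro divide_nonneg_nonneg integral_nonneg_AE) auto
    ultimately show ?thesis
      by (simp add: power_mult_distrib ennreal_power mult.assoc)
  qed
  \<comment> \<open>A supremum over the finite set F, hence clearly measurable; it stands in for the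
    squared maximal function, which dominates it pointwise.\<close>
  define h where "h x = (SUP \<alpha>\<in>F. ennreal ((A \<alpha>)\<^sup>2) * indicator (Q \<alpha>) x)" for x
  have "ennreal c1 * (\<Sum>\<alpha>\<in>F. ennreal ((A \<alpha>)\<^sup>2) * ((emeasure \<mu> (Q \<alpha>))\<^sup>2 * ennreal (\<pi> \<alpha>)))
      \<le> (\<integral>\<^sup>+x. h x \<partial>\<mu>)"
  proof (rule carleson_embedding[where R = Q])
    show "ennreal c1 * (\<Sum>\<alpha>\<in>G. (emeasure \<mu> (Q \<alpha>))\<^sup>2 * ennreal (\<pi> \<alpha>)) \<le> emeasure \<mu> (\<Union>\<alpha>\<in>G. Q \<alpha>)"
      if "G \<subseteq> F" for G
    proof -
      have G: "finite G" "G \<subseteq> Td" using that F finite_subset by auto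
      \<comment> \<open>Every \<open>Q \<alpha>\<close> with \<alpha> in G lies in this union, so
        the sum over G is part of the charge-energy sum for it.\<close>
      then have "rectangular (\<Union>\<alpha>\<in>G. Q \<alpha>)" by (auto simp: rectangular_def)
      from charge_energy[OF this] show ?thesis
        by (rule order_trans[rotated]) (use G in \<open>auto intro!: mult_left_mono member_le_infsum_ennreal\<close>)
    qed
    show "h \<in> borel_measurable \<mu>"
      unfolding h_def using F Q
      by (intro borel_measurable_SUP countable_finite borel_measurable_times_ennreal
          borel_measurable_const borel_measurable_indicator) auto
    show "ennreal ((A \<alpha>)\<^sup>2) \<le> h x" if "\<alpha> \<in> F" "x \<in> Q \<alpha>" for \<alpha> x
      unfolding h_def using that by (intro SUP_upper2[of \<alpha>]) auto
  qed (use F Q in auto)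
  also have "\<dots> \<le> (\<integral>\<^sup>+\<beta>\<in>boundary_Td. e2ennreal ((max_fun \<mu> g \<beta>)\<^sup>2) \<partial>\<mu>)"
  proof (intro nn_integral_mono)
    fix x
    show "h x \<le> e2ennreal ((max_fun \<mu> g x)\<^sup>2) * indicator boundary_Td x"
      unfolding h_def
    proof (intro SUP_least)
      fix \<alpha> assume "\<alpha> \<in> F"
      then show "ennreal ((A \<alpha>)\<^sup>2) * indicator (Q \<alpha>) x
          \<le> e2ennreal ((max_fun \<mu> g x)\<^sup>2) * indicator boundary_Td x"
        using max_fun_square_ge[of \<alpha> x g \<mu>] nonneg F
        by (auto simp: A_def Q_def succ_set_def indicator_def)
    qed
  qed
  finally show ?thesis
    using F by (simp add: avg subset_iff)
qed

theorem theorem4p1: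
  fixes s :: "'d::finite \<Rightarrow> real"
    and \<pi> :: "('d \<Rightarrow> tbar) \<Rightarrow> real"
    and \<mu> :: "('d \<Rightarrow> tbar) measure"
  assumes s: "\<And>j. 0 \<le> s j \<and> s j < 1"
    and \<pi>: "\<And>\<beta>. \<beta> \<in> Td \<Longrightarrow> \<pi> \<beta> = poly_weight s \<beta>"
    and borel: "sets \<mu> = sets borel_Td"
    and supp: "supp \<mu> \<subseteq> boundary_Td"
    and energy: "energy \<pi> \<mu> < \<infinity>"
    and charge_energy:
      "\<exists>c1::real. c1 > 0 \<and> (\<forall>E. rectangular E \<longrightarrow>
         emeasure \<mu> E \<ge>
           ennreal c1 * (\<Sum>\<^sub>\<infinity>\<alpha>\<in>{\<alpha> \<in> Td. Q \<alpha> \<subseteq> E}. (emeasure \<mu> (Q \<alpha>))\<^sup>2 * ennreal (\<pi> \<alpha>)))"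
    and maximal:
      "\<exists>c2::real. c2 > 0 \<and> (\<forall>g\<in>L2 \<mu>.
         (\<integral>\<^sup>+\<beta>\<in>boundary_Td. ennreal ((g \<beta>)\<^sup>2) \<partial>\<mu>) \<ge>
           ennreal c2 * (\<integral>\<^sup>+\<beta>\<in>boundary_Td. e2ennreal ((max_fun \<mu> g \<beta>)\<^sup>2) \<partial>\<mu>))"
  shows "\<exists>C::real. C \<ge> 0 \<and> (\<forall>g :: ('d \<Rightarrow> tbar) \<Rightarrow> real.
      g \<in> borel_measurable (completion \<mu>) \<longrightarrow> (\<forall>\<beta>. 0 \<le> g \<beta>) \<longrightarrow>
      (\<Sum>\<^sub>\<infinity>\<alpha>\<in>Td. (\<integral>\<^sup>+\<beta>\<in>succ_set \<alpha>. ennreal (g \<beta>) \<partial>completion \<mu>)\<^sup>2 * ennreal (\<pi> \<alpha>))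
        \<le> ennreal C * (\<integral>\<^sup>+\<beta>. ennreal ((g \<beta>)\<^sup>2) \<partial>completion \<mu>))"
proof -
  obtain c1 :: real where c1: "c1 > 0" "\<And>E. rectangular E \<Longrightarrow>
      ennreal c1 * (\<Sum>\<^sub>\<infinity>\<alpha>\<in>{\<alpha> \<in> Td. Q \<alpha> \<subseteq> E}. (emeasure \<mu> (Q \<alpha>))\<^sup>2 * ennreal (\<pi> \<alpha>))
        \<le> emeasure \<mu> E"
    using charge_energy by blast
  obtain c2 :: real where c2: "c2 > 0" "\<And>g. g \<in> L2 \<mu> \<Longrightarrow>
      ennreal c2 * (\<integral>\<^sup>+\<beta>\<in>boundary_Td. e2ennreal ((max_fun \<mu> g \<beta>)\<^sup>2) \<partial>\<mu>)
        \<le> (\<integral>\<^sup>+\<beta>\<in>boundary_Td. ennreal ((g \<beta>)\<^sup>2) \<partial>\<mu>)"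
    using maximal by blast
  have fin: "finite_measure \<mu>"
    using borel _ energy by (rule finite_measure_if_energy_finite) (simp add: \<pi> poly_weight_def prod_pos)
  have boundary: "AE x in \<mu>. x \<in> boundary_Td"
    using AE_in_supp[OF borel] by eventually_elim (use supp in auto)
  have "(\<Sum>\<^sub>\<infinity>\<alpha>\<in>Td. (\<integral>\<^sup>+\<beta>\<in>succ_set \<alpha>. ennreal (g \<beta>) \<partial>completion \<mu>)\<^sup>2 * ennreal (\<pi> \<alpha>))
      \<le> ennreal (1 / (c1 * c2)) * (\<integral>\<^sup>+\<beta>. ennreal ((g \<beta>)\<^sup>2) \<partial>completion \<mu>)"
    if g: "g \<in> borel_measurable (completion \<mu>)" and nonneg: "\<forall>\<beta>. 0 \<le> g \<beta>" for g
  \<comment> \<open>If the norm is infinite, so is the right-hand side, because the constant is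
    positive. Otherwise g has a representative in \<open>L2 \<mu>\<close>.\<close>
  proof (cases "(\<integral>\<^sup>+\<beta>. ennreal ((g \<beta>)\<^sup>2) \<partial>completion \<mu>) = \<infinity>")
    case True
    with c1(1) c2(1) show ?thesis by (simp add: ennreal_mult_top)
  next
    case False
    obtain f where f: "f \<in> borel_measurable \<mu>" "AE x in \<mu>. g x = f x"
      using completion_ex_borel_measurable_real[OF g] by blast
    \<comment> \<open>The Borel representative f may be negative on a null set; taking the positive
      part makes it nonnegative everywhere without changing any integral.\<close>
    define g' where "g' x = max 0 (f x)" for x
    have [measurable]: "g' \<in> borel_measurable \<mu>" unfolding g'_def using f(1) by measurable
    have eq: "AE x in \<mu>. g x = g' x"
      using f(2) by eventually_elim (use nonneg in \<open>metis g'_def max_absorb2\<close>)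
    have succ_eq: "(\<integral>\<^sup>+\<beta>\<in>succ_set \<alpha>. ennreal (g \<beta>) \<partial>completion \<mu>)
        = (\<integral>\<^sup>+\<beta>\<in>succ_set \<alpha>. ennreal (g' \<beta>) \<partial>\<mu>)" for \<alpha>
      unfolding nn_integral_completion using eq by (intro nn_integral_cong_AE) auto
    have norm_eq: "(\<integral>\<^sup>+\<beta>. ennreal ((g \<beta>)\<^sup>2) \<partial>completion \<mu>) = (\<integral>\<^sup>+\<beta>. ennreal ((g' \<beta>)\<^sup>2) \<partial>\<mu>)"
      unfolding nn_integral_completion using eq by (intro nn_integral_cong_AE) auto
    have L2: "g' \<in> L2 \<mu>"
      using False unfolding norm_eq L2_def
      by (auto intro!: integrableI_bounded simp: top.not_eq_extremum)
    show ?thesis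
      unfolding succ_eq norm_eq
    \<comment> \<open>An infinite sum in \<open>ennreal\<close> is bounded as soon as all its finite
      partial sums are, with a constant that does not depend on F.\<close>
    proof (rule infsum_le_finite_sums)
      fix F :: "('d \<Rightarrow> tbar) set" assume F: "finite F" "F \<subseteq> Td"
      let ?S = "\<Sum>\<alpha>\<in>F. (\<integral>\<^sup>+\<beta>\<in>succ_set \<alpha>. ennreal (g' \<beta>) \<partial>\<mu>)\<^sup>2 * ennreal (\<pi> \<alpha>)"
      have "ennreal c2 * (ennreal c1 * ?S)
          \<le> ennreal c2 * (\<integral>\<^sup>+\<beta>\<in>boundary_Td. e2ennreal ((max_fun \<mu> g' \<beta>)\<^sup>2) \<partial>\<mu>)"
        using trace_inequality_L2[OF borel fin boundary c1(2) L2 _ F]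
        by (intro mult_left_mono) (auto simp: g'_def)
      also have "\<dots> \<le> (\<integral>\<^sup>+\<beta>\<in>boundary_Td. ennreal ((g' \<beta>)\<^sup>2) \<partial>\<mu>)"
        by (rule c2(2)[OF L2])
      also have "\<dots> \<le> (\<integral>\<^sup>+\<beta>. ennreal ((g' \<beta>)\<^sup>2) \<partial>\<mu>)"
        by (intro nn_integral_mono) (auto simp: indicator_def)
      \<comment> \<open>Scaling by 1/(c1 c2) cancels both constants on the left, since they are
        positive and finite.\<close>
      finally have "ennreal (1 / (c1 * c2)) * (ennreal c2 * (ennreal c1 * ?S))
          \<le> ennreal (1 / (c1 * c2)) * (\<integral>\<^sup>+\<beta>. ennreal ((g' \<beta>)\<^sup>2) \<partial>\<mu>)"
        by (rule mult_left_mono) simp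
      moreover have "ennreal (1 / (c1 * c2)) * (ennreal c2 * (ennreal c1 * ?S)) = ?S"
      proof -
        have "ennreal (1 / (c1 * c2)) * (ennreal c2 * ennreal c1) = 1"
          using c1(1) c2(1) by (simp add: ennreal_mult[symmetric])
        then show ?thesis by (simp only: mult.assoc[symmetric] mult_1_left)
      qed
      ultimately show "?S \<le> ennreal (1 / (c1 * c2)) * (\<integral>\<^sup>+\<beta>. ennreal ((g' \<beta>)\<^sup>2) \<partial>\<mu>)"
        by simp
    qed (simp add: nonneg_summable_on_complete)
  qed
  moreover have "0 \<le> 1 / (c1 * c2)" using c1(1) c2(1) by simp
  ultimately show ?thesis by blast
qed

end
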